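(* Let $K$ be a simplicial complex over a type $E$, let $s \in K$ be a face, let $x \in E$ with $x \notin V(K)$, and let $\sigma_s K$ be the stellar subdivision of $K$ at $s$ with barycenter $x$. If $t \in K \setminus \mathrm{St}(K,s)$ and $t \notin \mathrm{Lk}(K,s) \star \partial s$, then \[ \mathrm{Lk}(\sigma_s K, t) = \mathrm{Lk}(K,t). \]
   Context: A simplicial complex over a type (set) $E$ is a set $K$ of nonempty finite subsets of $E$ (its faces) such that every nonempty subset of a face is a face. It may be empty or infinite, and not every element of $E$ need be a vertex. $V(K) = \{x \in E \mid \{x\} \in K\}$. For a finite set $s \subseteq E$: the link is $\mathrm{Lk}(K,s) = \{t \in K \mid s \cup t \in K,\ s \cap t = \emptyset\}$; the boundary is $\partial s = \{t \subseteq s \mid t \ne \emptyset,\ t \neq s\}$; the star complement, written $K \setminus \mathrm{St}(K,s)$, is $\{t \in K \mid s \not\subseteq t\}$. For complexes $A, B$ over $E$ with disjoint vertex sets, $A \star B$ (regarded as a complex over $E$) has as faces all nonempty sets $a \cup b$ with $a \in A \cup \{\emptyset\}$, $b \in B \cup \{\emptyset\}$. For $s \in K$ and $x \in E \setminus V(K)$, the stellar subdivision of $K$ at $s$ with barycenter $x$ is $\sigma_s K = (K \setminus \mathrm{St}(K,s)) \cup (\mathrm{Lk}(K,s) \star \partial s \star \{x\})$, where $\{x\}$ denotes the complex with single face $\{x\}$. That is, the faces of $\sigma_s K$ are the faces of $K$ not containing $s$ together with all nonempty sets $a \cup b \cup c$ with $a \in \mathrm{Lk}(K,s) \cup \{\emptyset\}$,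 $b \in \partial s \cup \{\emptyset\}$, $c \in \{\emptyset, \{x\}\}$. *)

theory Defs
  imports Main
begin

text \<open>A complex over the type \<open>'a\<close> is represented by its set of faces. It may be empty or infinite,
  and elements of \<open>'a\<close> need not be vertices.\<close>

definition simplicial_complex :: "'a set set \<Rightarrow> bool" where
  "simplicial_complex K \<longleftrightarrow>
     (\<forall>s\<in>K. finite s \<and> s \<noteq> {}) \<and>
     (\<forall>s\<in>K. \<forall>t. t \<subseteq> s \<and> t \<noteq> {} \<longrightarrow> t \<in> K)"

definition vertices :: "'a set set \<Rightarrow> 'a set" where
  "vertices K = {x. {x} \<in> K}"

definition link :: "'a set set \<Rightarrow> 'a set \<Rightarrow> 'a set set" where
  "link K s = {t \<in> K. s \<union> t \<in> K \<and> s \<inter> t = {}}"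

definition boundary :: "'a set \<Rightarrow> 'a set set" where
  "boundary s = {t. t \<subseteq> s \<and> t \<noteq> {} \<and> t \<noteq> s}"

definition star_complement :: "'a set set \<Rightarrow> 'a set \<Rightarrow> 'a set set" where
  "star_complement K s = {t \<in> K. \<not> s \<subseteq> t}"

text \<open>The join is meant for complexes with disjoint vertex sets. The formula is total; disjointness
  for the joins formed in a stellar subdivision is proved below.\<close>

definition join :: "'a set set \<Rightarrow> 'a set set \<Rightarrow> 'a set set"  (infixr \<open>\<star>\<close> 70) where
  "A \<star> B = {a \<union> b | a b. a \<in> insert {} A \<and> b \<in> insert {} B \<and> a \<union> b \<noteq> {}}"

definition stellar_subdivision :: "'a set set \<Rightarrow> 'a set \<Rightarrow> 'a \<Rightarrow> 'a set set" where
  "stellar_subdivision K s x =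
     star_complement K s \<union> (link K s \<star> boundary s \<star> {{x}})"

lemma mem_join_iff:
  "u \<in> A \<star> B \<longleftrightarrow> u \<noteq> {} \<and> (\<exists>a\<in>insert {} A. \<exists>b\<in>insert {} B. u = a \<union> b)"
  unfolding join_def mem_Collect_eq by blast

lemma bex_insert_empty_join:
  "(\<exists>d\<in>insert {} (A \<star> B). P d) \<longleftrightarrow> (\<exists>a\<in>insert {} A. \<exists>b\<in>insert {} B. P (a \<union> b))"
  (is "?L \<longleftrightarrow> ?R")
proof
  assume ?L
  then obtain d where d: "d = {} \<or> d \<in> A \<star> B" "P d"
    by blast
  then obtain a b where "a \<in> insert {} A" "b \<in> insert {} B" "d = a \<union> b"
    unfolding mem_join_iff by blast
  with d(2) show ?R
    by blast
next
  assume ?R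
  then obtain a b where ab: "a \<in> insert {} A" "b \<in> insert {} B" "P (a \<union> b)"
    by (elim bexE)
  then have "a \<union> b \<in> insert {} (A \<star> B)"
    unfolding insert_iff[of "a \<union> b"] mem_join_iff by blast
  with ab(3) show ?L
    by (rule bexI)
qed

lemma mem_stellar_subdivision_iff:
  "u \<in> stellar_subdivision K s x \<longleftrightarrow>
     u \<in> K \<and> \<not> s \<subseteq> u \<or>
     u \<noteq> {} \<and> (\<exists>a\<in>insert {} (link K s). \<exists>b\<in>insert {} (boundary s). \<exists>c\<in>{{}, {x}}. u = a \<union> b \<union> c)"
proof -
  have "u \<in> link K s \<star> boundary s \<star> {{x}} \<longleftrightarrow>
     u \<noteq> {} \<and> (\<exists>a\<in>insert {} (link K s). \<exists>b\<in>insert {} (boundary s). \<exists>c\<in>{{}, {x}}. u = a \<union> b \<union> c)"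
    unfolding mem_join_iff bex_insert_empty_join by (simp add: Un_assoc)
  then show ?thesis
    unfolding stellar_subdivision_def star_complement_def by blast
qed

lemma vertices_join: "vertices (A \<star> B) \<subseteq> vertices A \<union> vertices B"
proof
  fix v
  assume "v \<in> vertices (A \<star> B)"
  then obtain a b where ab: "a \<in> insert {} A" "b \<in> insert {} B" "{v} = a \<union> b"
    unfolding vertices_def mem_join_iff by auto
  then have "a = {v} \<or> b = {v}"
    by (metis singleton_Un_iff)
  with ab(1,2) show "v \<in> vertices A \<union> vertices B"
    unfolding vertices_def by auto
qed

lemma vertices_link_boundary_disjoint: "vertices (link K s) \<inter> vertices (boundary s) = {}"
  unfolding vertices_def link_def boundary_def by blast

lemma vertices_boundary_barycenter_disjoint:
  assumes "simplicial_complex K" "s \<in> K" "x \<notin> vertices K"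
  shows "vertices (boundary s) \<inter> vertices {{x}} = {}"
proof -
  have "x \<notin> s"
  proof
    assume "x \<in> s"
    then have "{x} \<subseteq> s \<and> {x} \<noteq> {}"
      by simp
    with assms(1,2) have "{x} \<in> K"
      unfolding simplicial_complex_def by blast
    with assms(3) show False
      by (simp add: vertices_def)
  qed
  then show ?thesis
    by (simp add: vertices_def boundary_def)
qed

lemma vertices_link_boundary_barycenter_disjoint:
  assumes "simplicial_complex K" "s \<in> K" "x \<notin> vertices K"
  shows "vertices (link K s) \<inter> vertices (boundary s \<star> {{x}}) = {}"
proof -
  have "vertices (link K s) \<inter> vertices {{x}} = {}"
    using assms(3) unfolding vertices_def link_def by auto
  then show ?thesis
    using vertices_link_boundary_disjoint[of K s] vertices_join[of "boundary s" "{{x}}"] by blast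
qed

end

theory Submission
  imports Defs
begin

text \<open>For a face \<open>t\<close> of \<open>K\<close> not containing \<open>s\<close>, lying outside \<open>Lk(K,s) \<star> \<partial>s\<close> means that
  \<open>s \<union> t\<close> is not a face. Hence no face of \<open>K\<close> above \<open>t\<close> contains \<open>s\<close>, so all of them survive the
  subdivision. Conversely, every face of the subdivision above \<open>t\<close> is an old one, since the part
  of a new face that avoids the barycenter lies in \<open>Lk(K,s) \<star> \<partial>s\<close>.\<close>

lemma simplicial_complex_subset:
  assumes "simplicial_complex K" "u \<in> K" "v \<subseteq> u" "v \<noteq> {}"
  shows "v \<in> K"
  using assms unfolding simplicial_complex_def by blast

text \<open>Splitting \<open>t\<close> along \<open>s\<close> gives the decomposition:
  \<open>t - s\<close> is empty or in the link because its union with \<open>s\<close> is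
  \<open>s \<union> t\<close>, and \<open>t \<inter> s\<close> is proper in \<open>s\<close> because
  \<open>s\<close> is not contained in \<open>t\<close>.\<close>

lemma mem_link_join_boundary:
  assumes "simplicial_complex K" "s \<union> t \<in> K" "t \<noteq> {}" "\<not> s \<subseteq> t"
  shows "t \<in> link K s \<star> boundary s"
proof -
  have "t - s \<in> insert {} (link K s)"
    using assms(2) simplicial_complex_subset[OF assms(1,2), of "t - s"]
    unfolding link_def by auto
  moreover have "t \<inter> s \<in> insert {} (boundary s)"
    using assms(4) unfolding boundary_def by blast
  moreover have "t = (t - s) \<union> (t \<inter> s)"
    by blast
  ultimately show ?thesis
    using assms(3) unfolding mem_join_iff by blast
qed

lemma link_subset_closed:
  assumes "simplicial_complex K" "a \<in> link K s" "a' \<subseteq> a" "a' \<noteq> {}"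
  shows "a' \<in> link K s"
proof -
  have a: "a \<in> K" "s \<union> a \<in> K" "s \<inter> a = {}"
    using assms(2) unfolding link_def by auto
  have "a' \<in> K" "s \<union> a' \<in> K"
    using simplicial_complex_subset[OF assms(1) a(1), of a']
      simplicial_complex_subset[OF assms(1) a(2), of "s \<union> a'"] assms(3,4) by auto
  then show ?thesis
    using a(3) assms(3) unfolding link_def by blast
qed

text \<open>Intersecting a new face \<open>a \<union> b \<union> c\<close> with \<open>t\<close>
  removes \<open>c\<close>, which is at most the barycenter, and shrinks \<open>a\<close> and
  \<open>b\<close> within their complexes, so \<open>t\<close> would lie in the excluded
  join.\<close>

lemma stellar_subdivision_face_above:
  assumes "simplicial_complex K" "u \<in> stellar_subdivision K s x" "t \<subseteq> u" "t \<noteq> {}" "x \<notin> t"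
    and "t \<notin> link K s \<star> boundary s"
  shows "u \<in> K"
proof (rule ccontr)
  assume "u \<notin> K"
  then obtain a b c where abc: "a \<in> insert {} (link K s)" "b \<in> insert {} (boundary s)"
    "c \<in> {{}, {x}}" "u = a \<union> b \<union> c"
    using assms(2) unfolding mem_stellar_subdivision_iff by blast
  have "a \<inter> t \<in> insert {} (link K s)"
    using abc(1) link_subset_closed[OF assms(1), of a s "a \<inter> t"] by auto
  moreover have "b \<inter> t \<in> insert {} (boundary s)"
    using abc(2) unfolding boundary_def by blast
  moreover have "t = (a \<inter> t) \<union> (b \<inter> t)"
    using abc(3,4) assms(3,5) by blast
  ultimately have "t \<in> link K s \<star> boundary s"
    using assms(4) unfolding mem_join_iff by blast
  with assms(6) show False ..
qed

theorem theorem3p7: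
  fixes K :: "'a set set" and s t :: "'a set" and x :: 'a
  assumes "simplicial_complex K"
    and "s \<in> K"
    and "x \<notin> vertices K"
    and "t \<in> star_complement K s"
    and "t \<notin> link K s \<star> boundary s"
  shows "link (stellar_subdivision K s x) t = link K t"
proof -
  note sub = simplicial_complex_subset[OF assms(1)]
  have t: "t \<in> K" "\<not> s \<subseteq> t"
    using assms(4) unfolding star_complement_def by auto
  have "t \<noteq> {}"
    using assms(1) t(1) unfolding simplicial_complex_def by blast
  have "x \<notin> t"
    using sub[OF t(1), of "{x}"] assms(3) unfolding vertices_def by auto
  have "s \<union> t \<notin> K"
    using mem_link_join_boundary[OF assms(1) _ \<open>t \<noteq> {}\<close> t(2)] assms(5) by blast
  show ?thesis
  proof (intro equalityI subsetI)
    fix u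
    assume "u \<in> link (stellar_subdivision K s x) t"
    then have u: "u \<in> stellar_subdivision K s x" "t \<union> u \<in> stellar_subdivision K s x" "t \<inter> u = {}"
      unfolding link_def by auto
    \<comment> \<open>The face to test is \<open>t \<union> u\<close>, since \<open>u\<close> is
      disjoint from \<open>t\<close> and so not above it; \<open>u\<close> then follows as a
      nonempty subset.\<close>
    have "t \<union> u \<in> K"
      by (rule stellar_subdivision_face_above[OF assms(1) u(2) _ \<open>t \<noteq> {}\<close> \<open>x \<notin> t\<close> assms(5)]) simp
    moreover have "u \<noteq> {}"
      using u(1) assms(1) unfolding mem_stellar_subdivision_iff simplicial_complex_def by blast
    ultimately have "u \<in> K"
      using sub[of "t \<union> u" u] by blast
    with \<open>t \<union> u \<in> K\<close> u(3) show "u \<in> link K t"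
      unfolding link_def by blast
  next
    fix u
    assume "u \<in> link K t"
    then have u: "u \<in> K" "t \<union> u \<in> K" "t \<inter> u = {}"
      unfolding link_def by auto
    \<comment> \<open>Otherwise \<open>s \<union> t\<close> would be a nonempty subset of the face
      \<open>t \<union> u\<close>. Hence both \<open>u\<close> and \<open>t \<union> u\<close> lie
      in the star complement of \<open>s\<close>.\<close>
    have "\<not> s \<subseteq> t \<union> u"
      using sub[OF u(2), of "s \<union> t"] \<open>s \<union> t \<notin> K\<close> \<open>t \<noteq> {}\<close> by blast
    then show "u \<in> link (stellar_subdivision K s x) t"
      using u unfolding link_def mem_stellar_subdivision_iff by blast
  qed
qed

end
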